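(* There is an absolute constant $C>0$ such that the following holds. Let $n,t\ge 1$, let $\delta\in(0,1)$, and let $v_1,\dots,v_t\in\mathbb{R}^n$ be arbitrary fixed vectors with $\|v_i\|_2\le 1$ for all $i\in[t]$. Run the randomized online procedure $\textsc{Balance}(v_1,\dots,v_t,\delta)$ described in the context. Then with probability at least $1-\delta$ the procedure does not fail and the partial sums satisfy $\|w_i\|_\infty\le C\log(nt/\delta)$ for all $i\in[t]$.
   Context: The procedure $\textsc{Balance}(v_1,\dots,v_t,\delta)$ processes the vectors online (when deciding $\varepsilon_i$ it only uses $v_1,\dots,v_i$ and its past random choices). It sets $w_0=0$ and $c=30\log(nt/\delta)$. For $i=1,\dots,t$: if $|\langle w_{i-1},v_i\rangle|>c$ or $\|w_{i-1}\|_\infty>c$, the procedure terminates with failure; otherwise it sets $p_i=\frac12-\frac{\langle w_{i-1},v_i\rangle}{2c}$, chooses $\varepsilon_i=1$ with probability $p_i$ and $\varepsilon_i=-1$ with probability $1-p_i$ (independently of everything else given the past), and sets $w_i=w_{i-1}+\varepsilon_i v_i$. Thus $w_i=\sum_{j\le i}\varepsilon_j v_j$. The vectors $v_1,\dots,v_t$ are fixed in advance (oblivious adversary).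
   Formalization: The bound on the partial sums is asserted only when nt/δ ≥ 2, which excludes just n = t = 1 with δ > 1/2, where the claim fails (v_1 = 1, δ near 1: |w_1| = 1 but log(1/δ) tends to 0); non-failure with probability at least 1−δ is still asserted there. *)

theory Defs
  imports "HOL-Probability.Probability"
begin

text \<open>
  The constant in the theorem must not depend on the dimension, so the dimension \<open>n\<close> has to be
  a number rather than a type: a vector of \<open>\<real>\<^sup>n\<close> is a function \<open>nat \<Rightarrow> real\<close> of which only
  the coordinates \<open>j < n\<close> are used. The input vectors are \<open>v 1, \<dots>, v t\<close>.
\<close>

definition inner_n :: "nat \<Rightarrow> (nat \<Rightarrow> real) \<Rightarrow> (nat \<Rightarrow> real) \<Rightarrow> real" where
  "inner_n n x y = (\<Sum>j<n. x j * y j)"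

definition l2_norm :: "nat \<Rightarrow> (nat \<Rightarrow> real) \<Rightarrow> real" where
  "l2_norm n x = L2_set x {..<n}"

text \<open>Meaningful for \<open>n \<ge> 1\<close> only (\<open>Max\<close> of a nonempty set).\<close>

definition linf_norm :: "nat \<Rightarrow> (nat \<Rightarrow> real) \<Rightarrow> real" where
  "linf_norm n x = (MAX j\<in>{..<n}. \<bar>x j\<bar>)"

definition signed_sum :: "(nat \<Rightarrow> nat \<Rightarrow> real) \<Rightarrow> (nat \<Rightarrow> real) \<Rightarrow> nat \<Rightarrow> nat \<Rightarrow> real" where
  "signed_sum v \<epsilon> i = (\<lambda>j. \<Sum>k=1..i. \<epsilon> k * v k j)"

text \<open>
  \<open>balance_step n c v i \<epsilon>\<close> performs step \<open>i \<ge> 1\<close> after the signs \<open>\<epsilon> 1, \<dots>, \<epsilon> (i - 1)\<close> have been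
  chosen; \<open>None\<close> is failure. When the test is passed and \<open>c > 0\<close>, the parameter of the Bernoulli
  distribution lies in \<open>[0, 1]\<close>, so the clipping built into \<open>bernoulli_pmf\<close> has no effect.
\<close>

definition balance_step ::
    "nat \<Rightarrow> real \<Rightarrow> (nat \<Rightarrow> nat \<Rightarrow> real) \<Rightarrow> nat \<Rightarrow> (nat \<Rightarrow> real) \<Rightarrow> (nat \<Rightarrow> real) option pmf" where
  "balance_step n c v i \<epsilon> =
    (let w = signed_sum v \<epsilon> (i - 1) in
     if \<bar>inner_n n w (v i)\<bar> > c \<or> linf_norm n w > c then return_pmf None
     else map_pmf (\<lambda>b. Some (\<epsilon>(i := if b then 1 else - 1)))
            (bernoulli_pmf (1 / 2 - inner_n n w (v i) / (2 * c))))"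

text \<open>The signs not yet chosen are set to \<open>0\<close>.\<close>

primrec balance_run ::
    "nat \<Rightarrow> real \<Rightarrow> (nat \<Rightarrow> nat \<Rightarrow> real) \<Rightarrow> nat \<Rightarrow> (nat \<Rightarrow> real) option pmf" where
  "balance_run n c v 0 = return_pmf (Some (\<lambda>_. 0))"
| "balance_run n c v (Suc i) =
    bind_pmf (balance_run n c v i)
      (\<lambda>r. case r of None \<Rightarrow> return_pmf None | Some \<epsilon> \<Rightarrow> balance_step n c v (Suc i) \<epsilon>)"

definition balance ::
    "nat \<Rightarrow> nat \<Rightarrow> (nat \<Rightarrow> nat \<Rightarrow> real) \<Rightarrow> real \<Rightarrow> (nat \<Rightarrow> real) option pmf" where
  "balance n t v \<delta> = balance_run n (30 * ln (real n * real t / \<delta>)) v t"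

end

theory Submission
  imports Defs
begin

text \<open>
  On the event of survival, a step replaces \<open>w\<close> by \<open>w + \<epsilon> v\<close> where \<open>\<epsilon> = \<plusminus>1\<close> has conditional mean
  \<open>-\<langle>w, v\<rangle> / c\<close>. By Hoeffding's lemma, the exponential moment of \<open>\<langle>\<theta>, w + \<epsilon> v\<rangle>\<close> is at most
  \<open>exp (s\<^sup>2 / 2)\<close> times that of \<open>\<langle>\<theta>', w\<rangle>\<close>, where \<open>s = \<langle>\<theta>, v\<rangle>\<close> and \<open>\<theta>' = \<theta> - (s / c) v\<close>. The loss
  \<open>s\<^sup>2 / 2\<close> is paid for by the decrease of \<open>c |\<theta>|\<^sup>2 / 2\<close> to \<open>c |\<theta>'|\<^sup>2 / 2\<close>, so \<open>w\<close> stays subgaussian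
  with variance proxy \<open>c\<close>. Hence each of the \<open>t (n + 1) + n\<close> bad events has probability at most
  \<open>2 exp (-c / 2) = 2 (\<delta> / (n t))\<^sup>1\<^sup>5\<close>, and a union bound finishes the proof.
\<close>

section \<open>Inner products, norms and signed sums\<close>

lemma inner_n_commute: "inner_n n x y = inner_n n y x"
  by (simp add: inner_n_def mult.commute)

lemma inner_n_add_scale_right:
  "inner_n n x (\<lambda>j. y j + a * z j) = inner_n n x y + a * inner_n n x z"
  by (simp add: inner_n_def algebra_simps sum.distrib sum_distrib_left)

lemma inner_n_add_scale_left:
  "inner_n n (\<lambda>j. y j + a * z j) x = inner_n n y x + a * inner_n n z x"
  by (simp add: inner_n_commute[of n _ x] inner_n_add_scale_right)

lemma inner_n_uminus_left: "inner_n n (\<lambda>j. - x j) y = - inner_n n x y"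
  by (simp add: inner_n_def sum_negf)

lemma inner_n_uminus_right: "inner_n n x (\<lambda>j. - y j) = - inner_n n x y"
  by (simp add: inner_n_def sum_negf)

lemma inner_n_indicator:
  assumes "j < n"
  shows "inner_n n (indicator {j}) x = x j"
proof -
  have "inner_n n (indicator {j}) x = (\<Sum>k<n. if k = j then x k else 0)"
    unfolding inner_n_def by (intro sum.cong) (auto simp: indicator_def)
  then show ?thesis using assms by simp
qed

lemma inner_n_self_le_one:
  assumes "l2_norm n x \<le> 1"
  shows "inner_n n x x \<le> 1"
  using assms by (simp add: l2_norm_def inner_n_def L2_set_def power2_eq_square)

lemma linf_norm_le_iff:
  assumes "n \<ge> 1"
  shows "linf_norm n x \<le> a \<longleftrightarrow> (\<forall>j<n. \<bar>x j\<bar> \<le> a)"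
  unfolding linf_norm_def using assms by (subst Max_le_iff) (auto simp: lessThan_empty_iff)

lemma signed_sum_Suc_upd:
  "signed_sum v (\<epsilon>(Suc i := a)) (Suc i) = (\<lambda>j. signed_sum v \<epsilon> i j + a * v (Suc i) j)"
  by (auto simp: signed_sum_def fun_eq_iff intro!: sum.cong)

lemma signed_sum_upd_later: "k < i \<Longrightarrow> signed_sum v (\<epsilon>(i := a)) k = signed_sum v \<epsilon> k"
  by (auto simp: signed_sum_def fun_eq_iff intro!: sum.cong)

section \<open>Exponential moments of the signed sums\<close>

text \<open>The left side is the moment generating function at \<open>s\<close> of a random sign
  with mean \<open>2 * p - 1\<close>. For negative \<open>s\<close>, the roles of \<open>p\<close>
  and \<open>1 - p\<close> are exchanged.\<close>

lemma Hoeffding_two_point: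
  fixes p s :: real
  assumes "0 \<le> p" "p \<le> 1"
  shows "p * exp s + (1 - p) * exp (- s) \<le> exp (s * (2 * p - 1) + s\<^sup>2 / 2)"
proof -
  have *: "q * exp h + (1 - q) * exp (- h) \<le> exp (h * (2 * q - 1) + h\<^sup>2 / 2)"
    if "0 \<le> q" "0 \<le> h" for q h :: real
  proof -
    \<comment> \<open>Factoring \<open>exp (- h)\<close> out of the two-point sum leaves
      \<open>y\<close>: the values -1 and 1 are shifted to 0 and 2, whence the argument
      \<open>2 * h\<close> below.\<close>
    define y where "y = 1 + q * (exp (2 * h) - 1)"
    have "y \<ge> 1" using that by (simp add: y_def)
    have "- (2 * h) * q + ln y \<le> (2 * h)\<^sup>2 / 8"
      unfolding y_def using that by (intro Hoeffdings_lemma_aux) auto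
    then have "ln y - h \<le> h * (2 * q - 1) + h\<^sup>2 / 2"
      by (simp add: algebra_simps)
    then have "exp (ln y - h) \<le> exp (h * (2 * q - 1) + h\<^sup>2 / 2)" by simp
    moreover have "exp (ln y - h) = y * exp (- h)"
      using \<open>y \<ge> 1\<close> by (simp add: exp_diff exp_minus field_simps)
    moreover have "exp (2 * h) * exp (- h) = exp h"
      by (simp flip: exp_add)
    then have "y * exp (- h) = q * exp h + (1 - q) * exp (- h)"
      by (simp add: y_def distrib_right left_diff_distrib right_diff_distrib)
    ultimately show ?thesis by simp
  qed
  show ?thesis
  proof (cases "s \<ge> 0")
    case True
    with * assms show ?thesis by simp
  next
    case False
    with *[of "1 - p" "- s"] assms show ?thesis by (simp add: algebra_simps)
  qed
qed

text \<open>Failed runs are weighted by 0, so a step that fails its test satisfies the bound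
  trivially and only the random sign has to be estimated.\<close>

lemma balance_step_exp_moment:
  fixes \<theta> :: "nat \<Rightarrow> real" and v :: "nat \<Rightarrow> nat \<Rightarrow> real" and n i :: nat
  assumes "c > 0"
  defines "s \<equiv> inner_n n \<theta> (v (Suc i))"
  shows "(\<integral>\<^sup>+r. (case r of None \<Rightarrow> 0 | Some \<epsilon>' \<Rightarrow>
              ennreal (exp (inner_n n \<theta> (signed_sum v \<epsilon>' (Suc i))))) \<partial>balance_step n c v (Suc i) \<epsilon>)
    \<le> ennreal (exp (s\<^sup>2 / 2)) *
        ennreal (exp (inner_n n (\<lambda>j. \<theta> j + (- s / c) * v (Suc i) j) (signed_sum v \<epsilon> i)))"
proof -
  define w where "w = signed_sum v \<epsilon> i"
  define x where "x = inner_n n w (v (Suc i))"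
  define p where "p = 1 / 2 - x / (2 * c)"
  show ?thesis
  proof (cases "\<bar>x\<bar> > c \<or> linf_norm n w > c")
    case True
    then show ?thesis by (simp add: balance_step_def w_def x_def)
  next
    case False
    then have p: "0 \<le> p" "p \<le> 1"
      using \<open>c > 0\<close> by (auto simp: p_def field_simps)
    define y where "y = inner_n n \<theta> w"
    have "(\<integral>\<^sup>+r. (case r of None \<Rightarrow> 0 | Some \<epsilon>' \<Rightarrow>
              ennreal (exp (inner_n n \<theta> (signed_sum v \<epsilon>' (Suc i))))) \<partial>balance_step n c v (Suc i) \<epsilon>)
       = (\<integral>\<^sup>+b. ennreal (exp (y + (if b then 1 else - 1) * s)) \<partial>bernoulli_pmf p)"
      using False
      by (simp add: balance_step_def w_def[symmetric] x_def[symmetric] p_def[symmetric]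
          signed_sum_Suc_upd inner_n_add_scale_right s_def[symmetric] y_def[symmetric]
          del: nn_integral_bernoulli_pmf fun_upd_apply)
    also have "\<dots> = ennreal (exp (y + s)) * ennreal p + ennreal (exp (y - s)) * ennreal (1 - p)"
      using p by simp
    also have "\<dots> = ennreal (exp y * (p * exp s + (1 - p) * exp (- s)))"
      using p by (simp add: exp_add exp_diff exp_minus field_simps flip: ennreal_mult ennreal_plus)
    also have "\<dots> \<le> ennreal (exp y * exp (s * (2 * p - 1) + s\<^sup>2 / 2))"
      using Hoeffding_two_point[OF p] by (intro ennreal_leI mult_left_mono) auto
    \<comment> \<open>Since \<open>2 * p - 1 = - x / c\<close>, the drift is linear in
      \<open>w\<close> and can be absorbed into the test vector.\<close>
    also have "exp y * exp (s * (2 * p - 1) + s\<^sup>2 / 2) = exp (s\<^sup>2 / 2) * exp (y + (- s / c) * x)"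
      using \<open>c > 0\<close> by (simp add: p_def field_simps flip: exp_add)
    also have "y + (- s / c) * x = inner_n n (\<lambda>j. \<theta> j + (- s / c) * v (Suc i) j) w"
      by (simp only: inner_n_add_scale_left y_def x_def inner_n_commute[of n w])
    finally show ?thesis by (simp add: w_def ennreal_mult)
  qed
qed

text \<open>The induction runs over all \<theta> at once, because a step trades \<theta> for the
  shifted vector \<open>\<theta>'\<close>.\<close>

lemma balance_run_exp_moment:
  assumes "c \<ge> 1" and "\<forall>k\<in>{1..i}. l2_norm n (v k) \<le> 1"
  shows "(\<integral>\<^sup>+r. (case r of None \<Rightarrow> 0 | Some \<epsilon> \<Rightarrow>
              ennreal (exp (inner_n n \<theta> (signed_sum v \<epsilon> i)))) \<partial>balance_run n c v i)
    \<le> ennreal (exp (c / 2 * inner_n n \<theta> \<theta>))"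
  using assms(2)
proof (induction i arbitrary: \<theta>)
  case 0
  have "inner_n n \<theta> \<theta> \<ge> 0" by (auto simp: inner_n_def intro!: sum_nonneg)
  moreover have "inner_n n \<theta> (signed_sum v (\<lambda>_. 0) 0) = 0"
    by (simp add: inner_n_def signed_sum_def)
  ultimately show ?case using \<open>c \<ge> 1\<close> by (simp flip: ennreal_1)
next
  case (Suc i)
  define u where "u = v (Suc i)"
  define s where "s = inner_n n \<theta> u"
  define \<theta>' where "\<theta>' = (\<lambda>j. \<theta> j + (- s / c) * u j)"
  have "(\<integral>\<^sup>+r. (case r of None \<Rightarrow> 0 | Some \<epsilon> \<Rightarrow>
              ennreal (exp (inner_n n \<theta> (signed_sum v \<epsilon> (Suc i))))) \<partial>balance_run n c v (Suc i))
      \<le> (\<integral>\<^sup>+r. ennreal (exp (s\<^sup>2 / 2)) * (case r of None \<Rightarrow> 0 | Some \<epsilon> \<Rightarrow>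
              ennreal (exp (inner_n n \<theta>' (signed_sum v \<epsilon> i)))) \<partial>balance_run n c v i)"
    unfolding balance_run.simps nn_integral_bind_pmf
    using \<open>c \<ge> 1\<close> balance_step_exp_moment[where c = c and n = n and \<theta> = \<theta> and v = v and i = i]
    by (intro nn_integral_mono) (auto simp: s_def u_def \<theta>'_def split: option.split)
  also have "\<dots> \<le> ennreal (exp (s\<^sup>2 / 2)) * ennreal (exp (c / 2 * inner_n n \<theta>' \<theta>'))"
    using Suc by (subst nn_integral_cmult) (auto intro!: mult_left_mono)
  also have "\<dots> = ennreal (exp (s\<^sup>2 / 2 + c / 2 * inner_n n \<theta>' \<theta>'))"
    by (simp add: exp_add ennreal_mult)
  also have "\<dots> \<le> ennreal (exp (c / 2 * inner_n n \<theta> \<theta>))"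
  proof -
    \<comment> \<open>The cross term gains \<open>2 * s\<^sup>2 / c\<close>; the quadratic term
      gives back at most \<open>s\<^sup>2 / c\<close>, as \<open>u\<close> has norm at most 1 and
      \<open>c \<ge> 1\<close>. The net gain, times \<open>c / 2\<close>, is exactly the Hoeffding
      loss.\<close>
    have "inner_n n \<theta>' \<theta>' = inner_n n \<theta> \<theta> - 2 * s\<^sup>2 / c + s\<^sup>2 / c\<^sup>2 * inner_n n u u"
      unfolding \<theta>'_def inner_n_add_scale_left inner_n_add_scale_right
      using \<open>c \<ge> 1\<close>
      by (simp add: inner_n_commute[of n u \<theta>] s_def[symmetric] power2_eq_square field_simps)
    also have "\<dots> \<le> inner_n n \<theta> \<theta> - 2 * s\<^sup>2 / c + s\<^sup>2 / c\<^sup>2 * 1"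
      using inner_n_self_le_one[of n u] Suc.prems
      by (intro add_left_mono mult_left_mono) (auto simp: u_def)
    also have "s\<^sup>2 / c\<^sup>2 * 1 \<le> s\<^sup>2 / c"
      using \<open>c \<ge> 1\<close> self_le_power[of c 2] by (simp add: divide_left_mono)
    finally have "inner_n n \<theta>' \<theta>' \<le> inner_n n \<theta> \<theta> - s\<^sup>2 / c" by simp
    then have "c / 2 * inner_n n \<theta>' \<theta>' \<le> c / 2 * (inner_n n \<theta> \<theta> - s\<^sup>2 / c)"
      using \<open>c \<ge> 1\<close> by (intro mult_left_mono) auto
    also have "\<dots> = c / 2 * inner_n n \<theta> \<theta> - s\<^sup>2 / 2"
      using \<open>c \<ge> 1\<close> by (simp add: field_simps)
    finally show ?thesis by (intro ennreal_leI) auto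
  qed
  finally show ?case .
qed

section \<open>Tail bounds\<close>

text \<open>Markov's inequality for the exponential moment. For variance proxy \<open>c\<close> and
  threshold \<open>c\<close> the optimal scaling of the exponent is 1, so \<open>u\<close> itself
  serves as \<theta>.\<close>

lemma balance_run_tail_upper:
  assumes "c \<ge> 1" and "\<forall>k\<in>{1..i}. l2_norm n (v k) \<le> 1" and u: "inner_n n u u \<le> 1"
  shows "measure_pmf.prob (balance_run n c v i)
           {r. \<exists>\<epsilon>. r = Some \<epsilon> \<and> inner_n n u (signed_sum v \<epsilon> i) > c} \<le> exp (- c / 2)"
    (is "measure_pmf.prob ?M ?A \<le> _")
proof -
  define f where "f = (\<lambda>r. case r of None \<Rightarrow> 0 | Some \<epsilon> \<Rightarrow>
                         ennreal (exp (inner_n n u (signed_sum v \<epsilon> i))))"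
  have "emeasure ?M ?A = (\<integral>\<^sup>+r. indicator ?A r \<partial>?M)" by simp
  also have "\<dots> \<le> (\<integral>\<^sup>+r. ennreal (exp (- c)) * f r \<partial>?M)"
    by (intro nn_integral_mono)
      (auto simp: f_def indicator_def simp flip: ennreal_mult exp_add ennreal_1 intro!: ennreal_leI)
  also have "\<dots> \<le> ennreal (exp (- c)) * ennreal (exp (c / 2 * inner_n n u u))"
    using balance_run_exp_moment[OF assms(1,2), of u]
    by (subst nn_integral_cmult) (auto simp: f_def intro!: mult_left_mono)
  also have "\<dots> = ennreal (exp (- c + c / 2 * inner_n n u u))"
    by (simp only: exp_add ennreal_mult exp_ge_zero)
  also have "\<dots> \<le> ennreal (exp (- c / 2))"
    using mult_left_mono[OF u, of "c / 2"] \<open>c \<ge> 1\<close>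
    by (intro ennreal_leI iffD2[OF exp_le_cancel_iff]) linarith
  finally show ?thesis by (simp add: measure_pmf.emeasure_eq_measure)
qed

lemma balance_run_tail:
  assumes "c \<ge> 1" and "\<forall>k\<in>{1..i}. l2_norm n (v k) \<le> 1" and "inner_n n u u \<le> 1"
  shows "measure_pmf.prob (balance_run n c v i)
           {r. \<exists>\<epsilon>. r = Some \<epsilon> \<and> \<bar>inner_n n u (signed_sum v \<epsilon> i)\<bar> > c} \<le> 2 * exp (- c / 2)"
    (is "measure_pmf.prob ?M ?A \<le> _")
proof -
  let ?B = "\<lambda>u. {r. \<exists>\<epsilon>. r = Some \<epsilon> \<and> inner_n n u (signed_sum v \<epsilon> i) > c}"
  have less_abs: "c < \<bar>a\<bar> \<longleftrightarrow> c < a \<or> c < - a" for a :: real by auto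
  have "?A = ?B u \<union> ?B (\<lambda>j. - u j)"
    unfolding inner_n_uminus_left less_abs by blast
  then have "measure_pmf.prob ?M ?A
      \<le> measure_pmf.prob ?M (?B u) + measure_pmf.prob ?M (?B (\<lambda>j. - u j))"
    by (simp add: measure_Un_le)
  also have "\<dots> \<le> exp (- c / 2) + exp (- c / 2)"
    using assms by (intro add_mono balance_run_tail_upper)
      (auto simp: inner_n_uminus_left inner_n_uminus_right)
  finally show ?thesis by simp
qed

text \<open>Coordinate \<open>j\<close> is the inner product with the unit vector
  \<open>indicator {j}\<close>, so a union bound over the \<open>n\<close> coordinates
  applies.\<close>

lemma balance_run_linf_tail:
  assumes "c \<ge> 1" "n \<ge> 1" "\<forall>k\<in>{1..i}. l2_norm n (v k) \<le> 1"
  shows "measure_pmf.prob (balance_run n c v i)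
           {r. \<exists>\<epsilon>. r = Some \<epsilon> \<and> linf_norm n (signed_sum v \<epsilon> i) > c} \<le> real n * (2 * exp (- c / 2))"
    (is "measure_pmf.prob ?M ?A \<le> _")
proof -
  let ?B = "\<lambda>j. {r. \<exists>\<epsilon>. r = Some \<epsilon> \<and> \<bar>inner_n n (indicator {j}) (signed_sum v \<epsilon> i)\<bar> > c}"
  have "?A = (\<Union>j<n. ?B j)"
    using linf_norm_le_iff[OF \<open>n \<ge> 1\<close>] by (auto simp: inner_n_indicator not_le[symmetric])
  then have "measure_pmf.prob ?M ?A \<le> (\<Sum>j<n. measure_pmf.prob ?M (?B j))"
    by (auto intro!: measure_pmf.finite_measure_subadditive_finite)
  also have "\<dots> \<le> (\<Sum>j<n. 2 * exp (- c / 2))"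
    using assms by (intro sum_mono balance_run_tail) (auto simp: inner_n_indicator)
  finally show ?thesis by simp
qed

section \<open>Failure and survival\<close>

lemma balance_run_fail_step:
  "pmf (balance_run n c v (Suc i)) None \<le> pmf (balance_run n c v i) None +
     measure_pmf.prob (balance_run n c v i)
       {r. \<exists>\<epsilon>. r = Some \<epsilon> \<and> \<bar>inner_n n (v (Suc i)) (signed_sum v \<epsilon> i)\<bar> > c} +
     measure_pmf.prob (balance_run n c v i)
       {r. \<exists>\<epsilon>. r = Some \<epsilon> \<and> linf_norm n (signed_sum v \<epsilon> i) > c}"
    (is "_ \<le> _ + measure_pmf.prob ?M ?A + measure_pmf.prob ?M ?B")
proof -
  let ?f = "\<lambda>r. case r of None \<Rightarrow> return_pmf None | Some \<epsilon> \<Rightarrow> balance_step n c v (Suc i) \<epsilon>"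
  \<comment> \<open>Given the past, failure is decided by the test alone: outside these events
    \<open>None\<close> has probability 0.\<close>
  have step: "pmf (?f r) None \<le> indicator ({None} \<union> ?A \<union> ?B) r" for r
  proof (cases r)
    case (Some \<epsilon>)
    show ?thesis
    proof (cases "r \<in> ?A \<union> ?B")
      case True
      then show ?thesis by (auto simp: pmf_le_1)
    next
      case False
      then have "None \<notin> set_pmf (?f r)"
        using Some by (auto simp: balance_step_def inner_n_commute[of n "v (Suc i)"])
      then show ?thesis by (simp add: set_pmf_iff)
    qed
  qed simp
  have "pmf (balance_run n c v (Suc i)) None = measure_pmf.expectation ?M (\<lambda>r. pmf (?f r) None)"
    by (simp add: pmf_bind)
  also have "\<dots> \<le> measure_pmf.expectation ?M (indicator ({None} \<union> ?A \<union> ?B))"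
    by (intro integral_mono step measure_pmf.integrable_const_bound[where B = 1])
      (auto simp: pmf_le_1)
  also have "\<dots> = measure_pmf.prob ?M ({None} \<union> ?A \<union> ?B)" by simp
  also have "\<dots> \<le> measure_pmf.prob ?M ({None} \<union> ?A) + measure_pmf.prob ?M ?B"
    by (rule measure_Un_le) auto
  also have "measure_pmf.prob ?M ({None} \<union> ?A) \<le> measure_pmf.prob ?M {None} + measure_pmf.prob ?M ?A"
    by (rule measure_Un_le) auto
  finally show ?thesis by (simp add: measure_pmf_single)
qed

text \<open>Each step contributes one tail event in the direction of the incoming vector and
  \<open>n\<close> coordinate events.\<close>

lemma balance_run_fail_le:
  assumes "c \<ge> 1" "n \<ge> 1" "\<forall>k\<in>{1..i}. l2_norm n (v k) \<le> 1"
  shows "pmf (balance_run n c v i) None \<le> real i * (real n + 1) * (2 * exp (- c / 2))"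
  using assms(3)
proof (induction i)
  case (Suc i)
  have "inner_n n (v (Suc i)) (v (Suc i)) \<le> 1"
    using Suc.prems by (intro inner_n_self_le_one) auto
  then show ?case
    using Suc balance_run_fail_step[of n c v i] balance_run_tail[of c i n v "v (Suc i)"]
      balance_run_linf_tail[of c n i v] assms(1,2)
    by (simp add: algebra_simps)
qed simp

text \<open>Step \<open>k + 1\<close> tests the sum after \<open>k\<close> steps, and later signs do
  not change that sum. The sum after step \<open>i\<close> is still untested, hence
  \<open>k < i\<close>.\<close>

lemma balance_run_past_bounded:
  assumes "Some \<epsilon> \<in> set_pmf (balance_run n c v i)" "k < i"
  shows "linf_norm n (signed_sum v \<epsilon> k) \<le> c"
  using assms
proof (induction i arbitrary: \<epsilon>)
  case (Suc i)
  from Suc.prems(1) obtain \<epsilon>' where \<epsilon>': "Some \<epsilon>' \<in> set_pmf (balance_run n c v i)"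
      and step: "Some \<epsilon> \<in> set_pmf (balance_step n c v (Suc i) \<epsilon>')"
    by (auto split: option.splits)
  from step obtain a where "\<epsilon> = \<epsilon>'(Suc i := a)" and "linf_norm n (signed_sum v \<epsilon>' i) \<le> c"
    by (auto simp: balance_step_def Let_def split: if_splits)
  with Suc.IH[OF \<epsilon>'] Suc.prems(2) show ?case
    by (cases "k = i") (auto simp: signed_sum_upd_later simp del: fun_upd_apply)
qed simp

text \<open>Besides the failure events, the final sum, which no test examines, costs
  \<open>n\<close> further coordinate events.\<close>

lemma balance_run_success:
  assumes "c \<ge> 1" "n \<ge> 1" "\<forall>k\<in>{1..t}. l2_norm n (v k) \<le> 1"
  shows "measure_pmf.prob (balance_run n c v t)
           {r. \<exists>\<epsilon>. r = Some \<epsilon> \<and> (\<forall>i\<in>{1..t}. linf_norm n (signed_sum v \<epsilon> i) \<le> c)}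
         \<ge> 1 - (real t * (real n + 1) + real n) * (2 * exp (- c / 2))"
    (is "measure_pmf.prob ?M ?G \<ge> _")
proof -
  let ?B = "{r. \<exists>\<epsilon>. r = Some \<epsilon> \<and> linf_norm n (signed_sum v \<epsilon> t) > c}"
  have "1 - measure_pmf.prob ?M ?G = measure_pmf.prob ?M (- ?G)"
    using measure_pmf.prob_compl[of ?G ?M] by (simp add: Compl_eq_Diff_UNIV)
  also have "\<dots> \<le> measure_pmf.prob ?M ({None} \<union> ?B)"
  proof (rule measure_pmf.finite_measure_mono_AE)
    \<comment> \<open>The inclusion is claimed only on the support: earlier sums are known to be
      bounded only for reachable outcomes.\<close>
    show "AE r in ?M. r \<in> - ?G \<longrightarrow> r \<in> {None} \<union> ?B"
    proof (rule AE_pmfI, rule impI)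
      fix r assume r: "r \<in> set_pmf ?M" "r \<in> - ?G"
      show "r \<in> {None} \<union> ?B"
      proof (cases r)
        case (Some \<epsilon>)
        with r obtain i where "i \<in> {1..t}" "\<not> linf_norm n (signed_sum v \<epsilon> i) \<le> c" by auto
        moreover from this have "\<not> i < t"
          using balance_run_past_bounded r(1) Some by blast
        ultimately show ?thesis using Some by auto
      qed simp
    qed
  qed simp
  also have "\<dots> \<le> measure_pmf.prob ?M {None} + measure_pmf.prob ?M ?B"
    by (rule measure_Un_le) auto
  also have "\<dots> \<le> real t * (real n + 1) * (2 * exp (- c / 2)) + real n * (2 * exp (- c / 2))"
    using balance_run_fail_le[OF assms] balance_run_linf_tail[OF assms]
    by (simp add: measure_pmf_single)
  finally show ?thesis by (simp add: algebra_simps)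
qed

text \<open>The only test concerns the zero sum. This serves the case \<open>n = t = 1\<close>,
  where \<open>c\<close> may be below 1 and the tail bounds do not apply.\<close>

lemma balance_run_one_no_fail:
  assumes "c \<ge> 0"
  shows "pmf (balance_run 1 c v 1) None = 0"
proof -
  have "signed_sum v (\<lambda>_. 0) 0 = (\<lambda>_. 0)" by (simp add: signed_sum_def)
  moreover have "linf_norm 1 (\<lambda>_. 0) \<le> c" using assms by (subst linf_norm_le_iff) auto
  moreover have "inner_n 1 (\<lambda>_. 0) (v 1) = 0" by (simp add: inner_n_def)
  ultimately show ?thesis
    using assms by (auto simp: balance_step_def bind_return_pmf set_pmf_iff[symmetric]
        pmf_eq_0_set_pmf)
qed

text \<open>If \<open>n * t / \<delta> < 2\<close>, then \<open>n = t = 1\<close>. As \<delta> tends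
  to 1 the logarithm then tends to 0, while the first sum can have absolute value 1, so no absolute
  \<open>C\<close> bounds it. In that case only the absence of failure is asserted.\<close>

theorem theorem1p1:
  "\<exists>C::real. C > 0 \<and>
    (\<forall>(n::nat) (t::nat) (\<delta>::real) (v :: nat \<Rightarrow> nat \<Rightarrow> real).
      n \<ge> 1 \<longrightarrow> t \<ge> 1 \<longrightarrow> 0 < \<delta> \<longrightarrow> \<delta> < 1 \<longrightarrow> (\<forall>i\<in>{1..t}. l2_norm n (v i) \<le> 1) \<longrightarrow>
      measure_pmf.prob (balance n t v \<delta>)
        {r. \<exists>\<epsilon>. r = Some \<epsilon> \<and>
             (real n * real t / \<delta> \<ge> 2 \<longrightarrow>
               (\<forall>i\<in>{1..t}. linf_norm n (signed_sum v \<epsilon> i) \<le> C * ln (real n * real t / \<delta>)))}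
      \<ge> 1 - \<delta>)"
\<comment> \<open>With \<open>C = 30\<close> the claimed bound is the threshold \<open>c\<close> of
  the procedure's own test.\<close>
proof (intro exI[of _ "30 :: real"] conjI allI impI)
  fix n t :: nat and \<delta> :: real and v :: "nat \<Rightarrow> nat \<Rightarrow> real"
  assume n: "n \<ge> 1" and t: "t \<ge> 1" and \<delta>: "0 < \<delta>" "\<delta> < 1"
    and v: "\<forall>i\<in>{1..t}. l2_norm n (v i) \<le> 1"
  define x where "x = real n * real t / \<delta>"
  define c where "c = 30 * ln x"
  let ?M = "balance_run n c v t"
  let ?G = "{r. \<exists>\<epsilon>. r = Some \<epsilon> \<and> (x \<ge> 2 \<longrightarrow> (\<forall>i\<in>{1..t}. linf_norm n (signed_sum v \<epsilon> i) \<le> c))}"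
  have nt1: "real n * real t \<ge> 1"
    using n t mult_mono[of 1 "real n" 1 "real t"] by simp
  have "x > 1" using nt1 \<delta> by (simp add: x_def)
  have "measure_pmf.prob ?M ?G \<ge> 1 - \<delta>"
  proof (cases "x \<ge> 2")
    case True
    have "ln x \<ge> ln 2" using True by simp
    then have "c \<ge> 1" using ln2_ge_two_thirds by (simp add: c_def)
    have "exp (- c / 2) = inverse (exp (15 * ln x))"
      by (simp add: c_def exp_minus)
    also have "exp (15 * ln x) = x ^ 15"
      using \<open>x > 1\<close> by (simp add: exp_of_nat_mult[of 15, simplified])
    finally have exp_c: "exp (- c / 2) = inverse (x ^ 15)" .
    have "real t * (real n + 1) + real n \<le> 3 * (real n * real t)"
    proof -
      have "real t \<le> real n * real t" "real n \<le> real n * real t"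
        using n t by (simp_all add: mult_le_cancel_right1 mult_le_cancel_left1)
      then show ?thesis by (simp add: algebra_simps)
    qed
    then have "(real t * (real n + 1) + real n) * (2 * exp (- c / 2))
        \<le> 3 * (real n * real t) * (2 * exp (- c / 2))"
      by (intro mult_right_mono) auto
    \<comment> \<open>Here \<open>n * t = \<delta> * x\<close>, which cancels one of the 15 factors
      \<open>inverse x\<close>.\<close>
    also have "\<dots> = 6 * \<delta> * inverse (x ^ 14)"
      using \<open>x > 1\<close> \<delta> nt1 unfolding exp_c
      by (simp add: x_def power_divide field_simps eval_nat_numeral)
    also have "\<dots> \<le> \<delta>"
    proof -
      have "(6::real) \<le> 2 ^ 14" by simp
      also have "\<dots> \<le> x ^ 14" using True by (intro power_mono) auto
      finally show ?thesis using \<delta> \<open>x > 1\<close> by (simp add: field_simps)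
    qed
    finally show ?thesis
      using balance_run_success[OF \<open>c \<ge> 1\<close> n v] True by simp
  next
    case False
    then have "real n * real t < 2" using \<delta> by (simp add: x_def field_simps)
    then have "n * t < 2" by (metis of_nat_less_iff of_nat_mult of_nat_numeral)
    then have nt: "n = 1" "t = 1"
      using n t mult_le_mono[of 2 n 1 t] mult_le_mono[of 1 n 2 t] by linarith+
    have "c \<ge> 0" using \<open>x > 1\<close> by (simp add: c_def)
    \<comment> \<open>For \<open>x < 2\<close> the norm bound in \<open>?G\<close> is
      vacuous.\<close>
    have "?G = - {None}" using False by auto
    then have "measure_pmf.prob ?M ?G = 1 - pmf ?M None"
      using measure_pmf.prob_compl[of "{None}" ?M]
      by (simp add: Compl_eq_Diff_UNIV measure_pmf_single)
    also have "\<dots> = 1"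
      using balance_run_one_no_fail[OF \<open>c \<ge> 0\<close>] nt by simp
    finally show ?thesis using \<delta> by simp
  qed
  then show "measure_pmf.prob (balance n t v \<delta>)
        {r. \<exists>\<epsilon>. r = Some \<epsilon> \<and>
             (real n * real t / \<delta> \<ge> 2 \<longrightarrow>
               (\<forall>i\<in>{1..t}. linf_norm n (signed_sum v \<epsilon> i) \<le> 30 * ln (real n * real t / \<delta>)))}
      \<ge> 1 - \<delta>"
    by (simp add: balance_def x_def c_def)
qed simp

end
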